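(* Let $t\in\mathcal{W}_2$ be a word of length $m$, and let $T=t*t*t*\cdots$ be the infinite word obtained by concatenating infinitely many copies of $t$. For $0\le i<m$ and $j\ge 0$, let $T_{i,j}$ be the subword of $T$ consisting of the $j$ consecutive letters of $T$ starting after the $i$-th letter, and write $T_k=T_{0,k}$. Suppose that for every $0\le i<m$, the set of values $k$ for which $T_{i,k}$ is in $\mathcal{U}(\{0,1\})$ is eventually periodic. Then for every word $u \in \mathcal{W}_2$, the set of values $k$ for which $u*T_k$ is in $\mathcal{U}(\{0,1\})$ is also eventually periodic.
   Context: $\mathcal{W}_2$ is the set of finite nonempty binary strings (words on the alphabet $\{0,1\}$), with multiplication $*$ given by concatenation; the size of a word is its length. The Ulam set $\mathcal{U}(\{0,1\})\subset\mathcal{W}_2$ is built as follows: first put the one-letter words $0$ and $1$ into it; then repeatedly add a shortest word not already in the set that can be written in exactly one way as a concatenation $v*w$ of two distinct words $v\neq w$ already in the set (representations are ordered pairs $(v,w)$). Ties among words of the same length may be broken arbitrarily without affecting the resulting set. Equivalently, a word $u$ of length at least $2$ is in $\mathcal{U}(\{0,1\})$ iff there is exactly one ordered pair $(v,w)$ of distinct elements of $\mathcal{U}(\{0,1\})$ with $u=v*w$. A set $A$ of nonnegative integers is eventually periodic if there exist $P>0$ and $K$ such that for all $k>K$, $k\in A$ if and only if $k+P\in A$. The word $u*T_0$ is understood to be $u$. *)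

theory Defs
  imports Main "HOL-Library.Stream"
begin

text \<open>The letters 0 and 1 are \<^term>\<open>False\<close> and \<^term>\<open>True\<close>; concatenation \<open>*\<close> is \<^term>\<open>(@)\<close>.\<close>

type_synonym word = "bool list"

definition W2 :: "word set" where
  "W2 = {w. w \<noteq> []}"

definition unique_rep :: "word set \<Rightarrow> word \<Rightarrow> bool" where
  "unique_rep S u \<longleftrightarrow> (\<exists>!p. fst p \<in> S \<and> snd p \<in> S \<and> fst p \<noteq> snd p \<and> u = fst p @ snd p)"

definition candidates :: "word set \<Rightarrow> word set" where
  "candidates S = {u \<in> W2. u \<notin> S \<and> unique_rep S u}"

definition shortest :: "word set \<Rightarrow> word set" where
  "shortest C = {u \<in> C. \<forall>v \<in> C. length u \<le> length v}"

text \<open>The greedy construction.  The order in which words of equal length are added is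
  immaterial, so each stage adds all the shortest candidates at once.\<close>

primrec ulam_stage :: "nat \<Rightarrow> word set" where
  "ulam_stage 0 = {[False], [True]}"
| "ulam_stage (Suc n) = ulam_stage n \<union> shortest (candidates (ulam_stage n))"

definition ulam :: "word set" where
  "ulam = (\<Union>n. ulam_stage n)"

text \<open>\<open>T_sub t i j\<close> is the word $T_{i,j}$: the \<open>j\<close> letters that follow the first \<open>i\<close> letters of
  $T = t*t*t*\cdots$ (meaningful for nonempty \<open>t\<close>).\<close>

definition T_sub :: "word \<Rightarrow> nat \<Rightarrow> nat \<Rightarrow> word" where
  "T_sub t i j = stake j (sdrop i (cycle t))"

definition eventually_periodic :: "nat set \<Rightarrow> bool" where
  "eventually_periodic A \<longleftrightarrow> (\<exists>P>0. \<exists>K. \<forall>k>K. k \<in> A \<longleftrightarrow> k + P \<in> A)"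

text \<open>The remaining facts show that the greedy construction agrees with the recursive
  description of the Ulam set (\<open>ulam_singleton\<close>, \<open>ulam_iff\<close>).\<close>

lemma ulam_stage_nonempty: "u \<in> ulam_stage n \<Longrightarrow> u \<noteq> []"
  by (induction n) (auto simp: shortest_def candidates_def W2_def)

lemma ulam_stage_mono: "m \<le> n \<Longrightarrow> ulam_stage m \<subseteq> ulam_stage n"
  by (induction n) (auto simp: le_Suc_eq)

lemma unique_rep_cong:
  assumes "[] \<notin> S" "[] \<notin> S'" "\<And>v. length v < length u \<Longrightarrow> v \<in> S \<longleftrightarrow> v \<in> S'"
  shows "unique_rep S u \<longleftrightarrow> unique_rep S' u"
proof -
  have "(x \<in> S \<and> y \<in> S \<and> x \<noteq> y \<and> u = x @ y) \<longleftrightarrow> (x \<in> S' \<and> y \<in> S' \<and> x \<noteq> y \<and> u = x @ y)"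
    for x y
  proof (cases "u = x @ y \<and> x \<noteq> [] \<and> y \<noteq> []")
    case True
    then have "length x < length u" "length y < length u" by auto
    then have "x \<in> S \<longleftrightarrow> x \<in> S'" "y \<in> S \<longleftrightarrow> y \<in> S'" using assms(3) by blast+
    then show ?thesis by simp
  next
    case False
    then show ?thesis using assms(1,2) by blast
  qed
  then show ?thesis unfolding unique_rep_def by simp
qed

lemma ulam_stage_stable:
  assumes no: "\<And>v. v \<in> candidates (ulam_stage n) \<Longrightarrow> L \<le> length v" and "n \<le> m"
  shows "(\<forall>v \<in> candidates (ulam_stage m). L \<le> length v) \<and>
         (\<forall>v. length v < L \<longrightarrow> (v \<in> ulam_stage m \<longleftrightarrow> v \<in> ulam_stage n))"
  using \<open>n \<le> m\<close>
proof (induction m rule: dec_induct)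
  case base
  then show ?case using no by blast
next
  case (step m)
  have eq: "v \<in> ulam_stage (Suc m) \<longleftrightarrow> v \<in> ulam_stage m" if "length v < L" for v
    using step.IH that by (auto simp: shortest_def)
  have "L \<le> length v" if v: "v \<in> candidates (ulam_stage (Suc m))" for v
  proof (rule ccontr)
    assume "\<not> L \<le> length v"
    then have l: "length v < L" by simp
    have "unique_rep (ulam_stage (Suc m)) v \<longleftrightarrow> unique_rep (ulam_stage m) v"
    proof (rule unique_rep_cong)
      show "[] \<notin> ulam_stage (Suc m)" "[] \<notin> ulam_stage m" using ulam_stage_nonempty by blast+
      show "w \<in> ulam_stage (Suc m) \<longleftrightarrow> w \<in> ulam_stage m" if "length w < length v" for w
        by (rule eq) (use l that in linarith)
    qed
    then have "v \<in> candidates (ulam_stage m)"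
      using v by (auto simp: candidates_def)
    then show False using step.IH l by fastforce
  qed
  then show ?case using step.IH eq by blast
qed

lemma candidates_length: "v \<in> candidates (ulam_stage n) \<Longrightarrow> n + 2 \<le> length v"
proof (induction n arbitrary: v)
  case 0
  then obtain p where p: "fst p \<in> ulam_stage 0" "snd p \<in> ulam_stage 0" "v = fst p @ snd p"
    unfolding candidates_def unique_rep_def by blast
  then have "length (fst p) = 1" "length (snd p) = 1" by auto
  then show ?case using p(3) by simp
next
  case (Suc n)
  have L: "n + 2 \<le> length w" if "w \<in> candidates (ulam_stage n)" for w
    using Suc.IH that by blast
  have st: "(\<forall>w \<in> candidates (ulam_stage (Suc n)). n + 2 \<le> length w) \<and>
        (\<forall>w. length w < n + 2 \<longrightarrow> (w \<in> ulam_stage (Suc n) \<longleftrightarrow> w \<in> ulam_stage n))"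
    by (rule ulam_stage_stable) (use L in auto)
  have "length v \<noteq> n + 2"
  proof
    assume l: "length v = n + 2"
    have "unique_rep (ulam_stage (Suc n)) v \<longleftrightarrow> unique_rep (ulam_stage n) v"
    proof (rule unique_rep_cong)
      show "[] \<notin> ulam_stage (Suc n)" "[] \<notin> ulam_stage n" using ulam_stage_nonempty by blast+
      show "w \<in> ulam_stage (Suc n) \<longleftrightarrow> w \<in> ulam_stage n" if "length w < length v" for w
        using st that l by metis
    qed
    then have "v \<in> candidates (ulam_stage n)"
      using Suc.prems by (auto simp: candidates_def)
    then have "v \<in> shortest (candidates (ulam_stage n))"
      using l L by (simp add: shortest_def)
    then show False using Suc.prems by (simp add: candidates_def)
  qed
  moreover have "n + 2 \<le> length v" using st Suc.prems by blast
  ultimately show ?case by simp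
qed

lemma ulam_stage_ulam:
  assumes no: "\<And>v. v \<in> candidates (ulam_stage n) \<Longrightarrow> L \<le> length v" and l: "length v < L"
  shows "v \<in> ulam \<longleftrightarrow> v \<in> ulam_stage n"
proof
  assume "v \<in> ulam"
  then obtain m where m: "v \<in> ulam_stage m" by (auto simp: ulam_def)
  then have "v \<in> ulam_stage (max m n)" using ulam_stage_mono[of m "max m n"] by auto
  then show "v \<in> ulam_stage n"
    using ulam_stage_stable[of n L "max m n"] no l by auto
qed (auto simp: ulam_def)

lemma ulam_nonempty: "[] \<notin> ulam"
  using ulam_stage_nonempty by (auto simp: ulam_def)

lemma ulam_subset_W2: "ulam \<subseteq> W2"
  using ulam_nonempty by (auto simp: W2_def)

lemma ulam_singleton: "[a] \<in> ulam"
  unfolding ulam_def by (rule UN_I[of 0]) (cases a; simp)+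

lemma unique_rep_ulam:
  assumes "\<And>v. v \<in> candidates (ulam_stage n) \<Longrightarrow> length u \<le> length v"
  shows "unique_rep (ulam_stage n) u \<longleftrightarrow> unique_rep ulam u"
proof (rule unique_rep_cong)
  show "[] \<notin> ulam_stage n" using ulam_stage_nonempty by blast
  show "[] \<notin> ulam" by (rule ulam_nonempty)
  show "v \<in> ulam_stage n \<longleftrightarrow> v \<in> ulam" if "length v < length u" for v
    using ulam_stage_ulam[of n "length u" v, OF assms that] by simp
qed

lemma ulam_iff:
  assumes "2 \<le> length u"
  shows "u \<in> ulam \<longleftrightarrow>
    (\<exists>!p. fst p \<in> ulam \<and> snd p \<in> ulam \<and> fst p \<noteq> snd p \<and> u = fst p @ snd p)"
proof -
  have "u \<in> ulam \<longleftrightarrow> unique_rep ulam u"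
  proof
    assume "u \<in> ulam"
    then obtain m where "u \<in> ulam_stage m" by (auto simp: ulam_def)
    then have "\<exists>n. u \<in> shortest (candidates (ulam_stage n))"
      using assms by (induction m) auto
    then obtain n where n: "u \<in> shortest (candidates (ulam_stage n))" ..
    then have "unique_rep (ulam_stage n) u"
      by (simp add: shortest_def candidates_def)
    then show "unique_rep ulam u"
      using unique_rep_ulam[of n u] n by (simp add: shortest_def)
  next
    assume r: "unique_rep ulam u"
    define n where "n = length u - 2"
    have L: "length u \<le> length v" if "v \<in> candidates (ulam_stage n)" for v
      using candidates_length[OF that] assms by (simp add: n_def)
    have "unique_rep (ulam_stage n) u" using unique_rep_ulam[of n u] L r by simp
    then have "u \<in> ulam_stage (Suc n)"
      using assms L by (auto simp: shortest_def candidates_def W2_def)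
    then show "u \<in> ulam" unfolding ulam_def by blast
  qed
  then show ?thesis by (simp add: unique_rep_def)
qed

end

theory Submission imports Defs begin

text \<open>
  Fix \<open>u\<close> and let \<open>F\<close> be the set of \<open>k\<close> with \<open>u * T\<^sub>k\<close> in the Ulam set.  The proof is by
  induction on the length of \<open>u\<close>; it turns membership in \<open>F\<close> into a recurrence with finite
  memory.

  A representation of \<open>u * T\<^sub>k\<close> is a position at which the word is cut.  The cuts inside \<open>u\<close>
  leave a right factor \<open>u' * T\<^sub>k\<close> with \<open>u'\<close> a proper suffix of \<open>u\<close>; by induction they contribute
  finitely many eventually periodic conditions on \<open>k\<close>.  A cut after \<open>u * T\<^sub>j\<close> is admissible when
  \<open>j \<in> F\<close> and \<open>k - j\<close> lies in the set of lengths at which the subwords of \<open>T\<close> that start at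
  offset \<open>j mod m\<close> are Ulam words, and this set is eventually periodic by hypothesis.

  The requirement that the two factors differ could disturb the recurrence only through the cut in
  the middle of the word.  If \<open>u * T\<close> is itself a shift of \<open>T\<close>, the claim is an instance of the
  hypothesis.  Otherwise \<open>u * T\<^sub>j\<close> is no subword of \<open>T\<close> once \<open>j\<close> is large, so that the
  requirement holds automatically for large \<open>k\<close> (\<open>unequal_factors\<close>).

  What is left is a statement about sets of numbers (\<open>self_convolution_eventually_periodic\<close>).
  Let \<open>P\<close> be a common period and \<open>K\<close> a common threshold.  It matters only whether the number of
  representations is \<open>0\<close>, \<open>1\<close> or more, and whether \<open>j < k - K\<close> contributes depends only on the
  residues of \<open>j\<close> and \<open>k\<close> modulo \<open>P\<close>.  In each residue class \<open>F\<close> either has finitely many elements,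
  or at some point it has two, after which further elements change nothing.  So for large \<open>k\<close>
  the early \<open>j\<close> contribute a periodic amount, up to this truncation, and membership of \<open>k\<close> in
  \<open>F\<close> is determined by \<open>k mod P\<close> and by \<open>F\<close> on the \<open>K\<close> numbers before \<open>k\<close>.  Such a
  recurrence has finitely many states, hence its solution is eventually periodic.
\<close>

section \<open>Eventually periodic sets\<close>

lemma periodic_multiple:
  fixes A :: "nat set"
  assumes "\<forall>k>K. k \<in> A \<longleftrightarrow> k + P \<in> A" "k > K" "P dvd Q"
  shows "k \<in> A \<longleftrightarrow> k + Q \<in> A"
proof -
  have "k \<in> A \<longleftrightarrow> k + P * n \<in> A" for n
  proof (induction n)
    case (Suc n)
    have "k + P * n \<in> A \<longleftrightarrow> (k + P * n) + P \<in> A"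
      using assms(1,2) by (meson trans_less_add1)
    then show ?case using Suc by (simp add: algebra_simps)
  qed simp
  then show ?thesis using \<open>P dvd Q\<close> by auto
qed

lemma common_period:
  assumes "finite \<A>" "\<And>A. A \<in> \<A> \<Longrightarrow> eventually_periodic A"
  shows "\<exists>P>0. \<exists>K. \<forall>A\<in>\<A>. \<forall>k>K. k \<in> A \<longleftrightarrow> k + P \<in> A"
  using assms
proof (induction \<A> rule: finite_induct)
  case (insert A \<A>)
  obtain P K where P: "P > 0" "\<forall>A\<in>\<A>. \<forall>k>K. k \<in> A \<longleftrightarrow> k + P \<in> A"
    using insert.IH insert.prems by auto
  obtain P' K' where P': "P' > 0" "\<forall>k>K'. k \<in> A \<longleftrightarrow> k + P' \<in> A"
    using insert.prems unfolding eventually_periodic_def by blast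
  have "k \<in> A' \<longleftrightarrow> k + P * P' \<in> A'" if "A' \<in> insert A \<A>" "k > max K K'" for A' k
  proof (cases "A' = A")
    case True
    have "k \<in> A \<longleftrightarrow> k + P * P' \<in> A"
      by (rule periodic_multiple[OF P'(2)]) (use that(2) in auto)
    then show ?thesis using True by simp
  next
    case False
    then have "\<forall>k>K. k \<in> A' \<longleftrightarrow> k + P \<in> A'" using P(2) that(1) by blast
    then show ?thesis by (rule periodic_multiple) (use that(2) in auto)
  qed
  then show ?case using P(1) P'(1) by (metis nat_0_less_mult_iff)
qed auto

lemma eventually_periodic_shift:
  assumes "eventually_periodic A"
  shows "eventually_periodic {k. a + k \<in> A}"
proof -
  obtain P K where "P > 0" "\<forall>k>K. k \<in> A \<longleftrightarrow> k + P \<in> A"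
    using assms unfolding eventually_periodic_def by blast
  then have "a + k \<in> A \<longleftrightarrow> a + k + P \<in> A" if "k > K" for k
    using that trans_less_add2 by blast
  then show ?thesis
    using \<open>P > 0\<close> unfolding eventually_periodic_def by (metis add.assoc mem_Collect_eq)
qed

lemma eventually_periodic_conj_const:
  assumes "c \<Longrightarrow> eventually_periodic A"
  shows "eventually_periodic {k. c \<and> k \<in> A}"
  using assms by (cases c) (auto simp: eventually_periodic_def)

text \<open>Among the windows of length \<open>K\<close> that start at multiples of \<open>P\<close>, two agree, because there are
  only finitely many patterns.  From there on the recurrence produces the same sequence twice.\<close>

lemma finite_memory_eventually_periodic:
  fixes F :: "nat set"
  assumes "P > 0"
    and memory: "\<And>k Q. \<lbrakk>k \<ge> L; P dvd Q; \<And>d. \<lbrakk>0 < d; d \<le> K\<rbrakk> \<Longrightarrow> k - d \<in> F \<longleftrightarrow> k + Q - d \<in> F\<rbrakk>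
           \<Longrightarrow> k \<in> F \<longleftrightarrow> k + Q \<in> F"
  shows "eventually_periodic F"
proof -
  define window where "window n = {x. x < K \<and> L + n * P + x \<in> F}" for n
  have "range window \<subseteq> Pow {..<K}" by (auto simp: window_def)
  then have "finite (range window)" by (rule finite_subset) simp
  then have "\<not> inj window" using finite_imageD by blast
  then obtain a b where ab: "a < b" "window a = window b"
    by (metis injI linorder_neqE_nat)
  define Q where "Q = (b - a) * P"
  have shift: "L + b * P + x = L + a * P + x + Q" for x
    using ab(1) by (simp add: Q_def diff_mult_distrib)
  have step: "L + a * P + x \<in> F \<longleftrightarrow> L + a * P + x + Q \<in> F" for x
  proof (induction x rule: less_induct)
    case (less x)
    show ?case
    proof (cases "x < K")
      case True
      then have "x \<in> window a \<longleftrightarrow> x \<in> window b" using ab(2) by simp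
      then show ?thesis using True shift[of x] by (simp add: window_def)
    next
      case False
      show ?thesis
      proof (rule memory)
        show "P dvd Q" by (simp add: Q_def)
        show "L + a * P + x - d \<in> F \<longleftrightarrow> L + a * P + x + Q - d \<in> F" if "0 < d" "d \<le> K" for d
        proof -
          have "L + a * P + x - d = L + a * P + (x - d)" "L + a * P + x + Q - d = L + a * P + (x - d) + Q"
            using that False by linarith+
          moreover have "L + a * P + (x - d) \<in> F \<longleftrightarrow> L + a * P + (x - d) + Q \<in> F"
            by (rule less) (use that False in linarith)
          ultimately show ?thesis by (simp only:)
        qed
      qed simp
    qed
  qed
  have "k \<in> F \<longleftrightarrow> k + Q \<in> F" if "k > L + a * P" for k
    using step[of "k - (L + a * P)"] that by simp
  moreover have "Q > 0" using ab(1) \<open>P > 0\<close> by (simp add: Q_def)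
  ultimately show ?thesis unfolding eventually_periodic_def by blast
qed

text \<open>Beyond a suitable bound a residue class can show nothing new to a count that is truncated at
  two: it meets \<open>F\<close> no more, or it has met \<open>F\<close> twice already.\<close>

lemma residue_classes_settle:
  fixes F :: "nat set"
  assumes "P > 0"
  obtains M where "\<And>j. \<lbrakk>j \<ge> M; j \<in> F\<rbrakk> \<Longrightarrow>
    \<exists>x y. x < y \<and> y < M \<and> x \<in> F \<and> y \<in> F \<and> x mod P = j mod P \<and> y mod P = j mod P"
proof -
  define settled where "settled r M \<longleftrightarrow> (\<forall>j\<ge>M. j \<in> F \<and> j mod P = r \<longrightarrow>
    (\<exists>x y. x < y \<and> y < M \<and> x \<in> F \<and> y \<in> F \<and> x mod P = r \<and> y mod P = r))" for r M
  have "eventually (settled r) sequentially" for r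
  proof (cases "\<exists>x y. x < y \<and> x \<in> F \<and> y \<in> F \<and> x mod P = r \<and> y mod P = r")
    case True
    then obtain x y where xy: "x < y" "x \<in> F" "y \<in> F" "x mod P = r" "y mod P = r" by blast
    then have "settled r M" if "M \<ge> Suc y" for M
      unfolding settled_def using xy that Suc_le_lessD by blast
    then show ?thesis unfolding eventually_sequentially by blast
  next
    case unique: False
    show ?thesis
    proof (cases "\<exists>z. z \<in> F \<and> z mod P = r")
      case True
      then obtain z where "z \<in> F" "z mod P = r" by blast
      have "settled r M" if "M \<ge> Suc z" for M
      proof -
        have False if j: "j \<ge> M" "j \<in> F" "j mod P = r" for j
        proof -
          have "z < j" using \<open>M \<ge> Suc z\<close> j(1) by linarith
          then show False using unique \<open>z \<in> F\<close> \<open>z mod P = r\<close> j(2,3) by blast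
        qed
        then show ?thesis unfolding settled_def by blast
      qed
      then show ?thesis unfolding eventually_sequentially by blast
    next
      case False
      then have "settled r M" for M unfolding settled_def by blast
      then show ?thesis by (simp add: always_eventually)
    qed
  qed
  then have "eventually (\<lambda>M. \<forall>r\<in>{..<P}. settled r M) sequentially"
    by (intro eventually_ball_finite) auto
  then obtain M where "\<forall>r\<in>{..<P}. settled r M"
    unfolding eventually_sequentially by blast
  then have "settled (j mod P) M" for j using assms by simp
  then show thesis by (intro that[of M]) (auto simp: settled_def)
qed

text \<open>The set \<open>F\<close> is defined by counting, with the count compared to \<open>1\<close>, the periodic conditions
  \<open>G\<close> together with a convolution of \<open>F\<close> with periodic sets.\<close>

lemma self_convolution_eventually_periodic:
  fixes F :: "nat set" and B :: "nat \<Rightarrow> nat set" and G :: "'c \<Rightarrow> nat set"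
  assumes "m > 0" "finite C"
    and B: "\<And>i. i < m \<Longrightarrow> eventually_periodic (B i)"
    and G: "\<And>c. c \<in> C \<Longrightarrow> eventually_periodic (G c)"
    and rec: "\<And>k. k \<ge> L \<Longrightarrow>
      k \<in> F \<longleftrightarrow> card {c\<in>C. k \<in> G c} + card {j. j < k \<and> j \<in> F \<and> k - j \<in> B (j mod m)} = 1"
  shows "eventually_periodic F"
proof -
  have "\<exists>P>0. \<exists>K. \<forall>A \<in> B ` {..<m} \<union> G ` C. \<forall>k>K. k \<in> A \<longleftrightarrow> k + P \<in> A"
    using assms by (intro common_period) auto
  then obtain P0 K where "P0 > 0" and P0: "\<forall>A \<in> B ` {..<m} \<union> G ` C. \<forall>k>K. k \<in> A \<longleftrightarrow> k + P0 \<in> A"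
    by blast
  define P where "P = P0 * m"
  have "P > 0" using \<open>P0 > 0\<close> \<open>m > 0\<close> by (simp add: P_def)
  have per: "k \<in> A \<longleftrightarrow> k + Q \<in> A" if "A \<in> B ` {..<m} \<union> G ` C" "k > K" "P dvd Q" for A k Q
    using periodic_multiple[of K A P0 k Q] P0 that by (metis P_def dvd_mult_left)
  obtain M where M: "\<And>j. \<lbrakk>j \<ge> M; j \<in> F\<rbrakk> \<Longrightarrow>
      \<exists>x y. x < y \<and> y < M \<and> x \<in> F \<and> y \<in> F \<and> x mod P = j mod P \<and> y mod P = j mod P"
    using residue_classes_settle[OF \<open>P > 0\<close>] by blast
  define early where "early k = {j. j < k - K \<and> j \<in> F \<and> k - j \<in> B (j mod m)}" for k
  define late where "late k = {d. 0 < d \<and> d \<le> K \<and> k - d \<in> F \<and> d \<in> B ((k - d) mod m)}" for k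
  have fin: "finite (early k)" "finite (late k)" for k
    unfolding early_def late_def by (auto intro: finite_subset[of _ "{..<k}"] finite_subset[of _ "{..K}"])
  have split: "card {j. j < k \<and> j \<in> F \<and> k - j \<in> B (j mod m)} = card (early k) + card (late k)"
    if "k > K" for k
  proof -
    have "{j. j < k \<and> j \<in> F \<and> k - j \<in> B (j mod m)} = early k \<union> (\<lambda>d. k - d) ` late k"
    proof (intro set_eqI iffI)
      fix j assume j: "j \<in> {j. j < k \<and> j \<in> F \<and> k - j \<in> B (j mod m)}"
      show "j \<in> early k \<union> (\<lambda>d. k - d) ` late k"
      proof (cases "j < k - K")
        case False
        then have "k - j \<in> late k" using j by (auto simp: late_def)
        moreover have "j = k - (k - j)" using j by simp
        ultimately show ?thesis by blast
      qed (use j in \<open>simp add: early_def\<close>)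
    qed (use that in \<open>auto simp: early_def late_def\<close>)
    moreover have "early k \<inter> (\<lambda>d. k - d) ` late k = {}"
      using that by (auto simp: early_def late_def)
    moreover have "inj_on (\<lambda>d. k - d) (late k)"
      using that by (auto simp: inj_on_def late_def)
    ultimately show ?thesis using fin by (simp add: card_Un_disjoint card_image)
  qed
  \<comment> \<open>The two counts of early contributions may differ, but only above the value \<open>1\<close>: a new
    contribution in the later one comes from a residue class with two elements below \<open>M\<close>, which
    contribute to both.\<close>
  have early_cases: "early k = early (k + Q) \<or> (card (early k) \<ge> 2 \<and> card (early (k + Q)) \<ge> 2)"
    if k: "k \<ge> M + K" and Q: "P dvd Q" for k Q
  proof -
    have shift: "k - j \<in> B (j mod m) \<longleftrightarrow> k + Q - j \<in> B (j mod m)" if "j < k - K" for j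
    proof -
      have "k + Q - j = (k - j) + Q" using that by simp
      then show ?thesis using per[of "B (j mod m)" "k - j" Q] that Q \<open>m > 0\<close> by simp
    qed
    then have sub: "early k \<subseteq> early (k + Q)" unfolding early_def by auto
    show ?thesis
    proof (cases "early k = early (k + Q)")
      case False
      then obtain j where j: "j \<in> early (k + Q)" "j \<notin> early k" using sub by blast
      then have "j \<ge> k - K" using shift[of j] unfolding early_def by fastforce
      then have jM: "j \<ge> M" using k by linarith
      have jF: "j \<in> F" "k + Q - j \<in> B (j mod m)" "j < k + Q - K"
        using j(1) by (auto simp: early_def)
      obtain x y where xy: "x < y" "y < M" "x \<in> F" "y \<in> F" "x mod P = j mod P" "y mod P = j mod P"
        using M[OF jM jF(1)] by blast
      have mem: "z \<in> early k" if z: "z < M" "z \<in> F" "z mod P = j mod P" for z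
      proof -
        have dvd: "P dvd j - z" using z(3) jM z(1) by (metis less_le_trans mod_eq_dvd_iff_nat nat_less_le)
        have "m dvd P" by (simp add: P_def)
        then have zm: "z mod m = j mod m" using z(3) by (metis mod_mod_cancel)
        have "k + Q - z = (k + Q - j) + (j - z)" using jF(3) z(1) jM by simp
        moreover have "(k + Q - j) + (j - z) \<in> B (j mod m)"
          using per[of "B (j mod m)" "k + Q - j" "j - z", OF _ _ dvd] jF(2,3) \<open>m > 0\<close> by auto
        ultimately have "k + Q - z \<in> B (z mod m)" by (simp only: zm)
        moreover have "z < k - K" using z(1) k by simp
        ultimately show ?thesis using z(2) shift[of z] by (simp add: early_def)
      qed
      have "{x, y} \<subseteq> early k" using mem xy by simp
      then have "card {x, y} \<le> card (early k)" by (rule card_mono[OF fin(1)])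
      then have "2 \<le> card (early k)" using xy(1) by simp
      moreover have "card (early k) \<le> card (early (k + Q))" by (rule card_mono[OF fin(1) sub])
      ultimately show ?thesis by simp
    qed simp
  qed
  show ?thesis
  proof (rule finite_memory_eventually_periodic[OF \<open>P > 0\<close>, of "Suc (L + M + K)" K])
    fix k Q
    assume k: "Suc (L + M + K) \<le> k" and Q: "P dvd Q"
      and recent: "\<And>d. \<lbrakk>0 < d; d \<le> K\<rbrakk> \<Longrightarrow> k - d \<in> F \<longleftrightarrow> k + Q - d \<in> F"
    have G_eq: "{c\<in>C. k + Q \<in> G c} = {c\<in>C. k \<in> G c}"
      using per[of _ k Q] Q k by auto
    have "m dvd Q" using Q by (metis P_def dvd_mult_right)
    have "(k + Q - d) mod m = (k - d) mod m" if "d \<le> K" for d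
    proof -
      have "k + Q - d = (k - d) + Q" using k that by simp
      then show ?thesis using \<open>m dvd Q\<close> by (metis add_0_right dvd_imp_mod_0 mod_add_right_eq)
    qed
    then have late_eq: "late (k + Q) = late k" unfolding late_def using recent by auto
    have "k \<in> F \<longleftrightarrow> card {c\<in>C. k \<in> G c} + (card (early k) + card (late k)) = 1"
      using rec[of k] split[of k] k by simp
    moreover have "k + Q \<in> F \<longleftrightarrow> card {c\<in>C. k \<in> G c} + (card (early (k + Q)) + card (late k)) = 1"
      using rec[of "k + Q"] split[of "k + Q"] k by (simp add: G_eq late_eq)
    moreover have "early k = early (k + Q) \<or> (card (early k) \<ge> 2 \<and> card (early (k + Q)) \<ge> 2)"
      using early_cases[of k Q] k Q by simp
    ultimately show "k \<in> F \<longleftrightarrow> k + Q \<in> F" by auto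
  qed
qed

section \<open>Representations as cut positions\<close>

text \<open>The bound on \<open>c\<close> keeps distinct positions from cutting \<open>w\<close> in the same way.\<close>

lemma ulam_iff_cuts:
  assumes "2 \<le> length w"
  shows "w \<in> ulam \<longleftrightarrow>
    card {c. c \<le> length w \<and> take c w \<in> ulam \<and> drop c w \<in> ulam \<and> take c w \<noteq> drop c w} = 1"
    (is "_ \<longleftrightarrow> card ?C = 1")
proof -
  let ?R = "{p. fst p \<in> ulam \<and> snd p \<in> ulam \<and> fst p \<noteq> snd p \<and> w = fst p @ snd p}"
  have "bij_betw (\<lambda>c. (take c w, drop c w)) ?C ?R"
    by (rule bij_betw_byWitness[where f' = "\<lambda>p. length (fst p)"]) auto
  then have "card ?C = card ?R" by (rule bij_betw_same_card)
  moreover have "w \<in> ulam \<longleftrightarrow> (\<exists>!p. p \<in> ?R)"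
    unfolding ulam_iff[OF assms] mem_Collect_eq ..
  ultimately show ?thesis by (simp only: is_singleton_iff_ex1 flip: is_singleton_altdef)
qed

section \<open>Subwords of the periodic word\<close>

lemma length_T_sub [simp]: "length (T_sub t i k) = k"
  by (simp add: T_sub_def)

lemma T_sub_0_right [simp]: "T_sub t i 0 = []"
  by (simp add: T_sub_def)

lemma take_T_sub: "j \<le> k \<Longrightarrow> take j (T_sub t i k) = T_sub t i j"
  by (simp add: T_sub_def take_stake min_def)

lemma drop_T_sub: "drop j (T_sub t i k) = T_sub t (i + j) (k - j)"
  by (simp add: T_sub_def drop_stake add.commute)

lemma T_sub_mod: "t \<noteq> [] \<Longrightarrow> T_sub t (i mod length t) k = T_sub t i k"
  by (simp add: T_sub_def sdrop_cycle)

text \<open>Two infinite words that differ have different prefixes from some length on, and \<open>T\<close> has only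
  finitely many shifts.\<close>

lemma not_shift_eventually_not_subword:
  assumes "\<And>i. i < m \<Longrightarrow> \<exists>n. u @ T_sub t 0 n \<noteq> T_sub t i (length u + n)"
  obtains N where "\<And>n i. \<lbrakk>n \<ge> N; i < m\<rbrakk> \<Longrightarrow> u @ T_sub t 0 n \<noteq> T_sub t i (length u + n)"
proof -
  have "eventually (\<lambda>n. u @ T_sub t 0 n \<noteq> T_sub t i (length u + n)) sequentially" if i: "i < m" for i
  proof -
    obtain N where N: "u @ T_sub t 0 N \<noteq> T_sub t i (length u + N)"
      using assms[OF i] by blast
    have "u @ T_sub t 0 n \<noteq> T_sub t i (length u + n)" if "n \<ge> N" for n
    proof
      assume "u @ T_sub t 0 n = T_sub t i (length u + n)"
      then have "take (length u + N) (u @ T_sub t 0 n) = take (length u + N) (T_sub t i (length u + n))"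
        by simp
      then show False using N that by (simp add: take_T_sub)
    qed
    then show ?thesis unfolding eventually_sequentially by blast
  qed
  then have "eventually (\<lambda>n. \<forall>i\<in>{..<m}. u @ T_sub t 0 n \<noteq> T_sub t i (length u + n)) sequentially"
    by (intro eventually_ball_finite) auto
  then obtain N where "\<forall>n\<ge>N. \<forall>i\<in>{..<m}. u @ T_sub t 0 n \<noteq> T_sub t i (length u + n)"
    unfolding eventually_sequentially by blast
  then show thesis by (intro that[of N]) auto
qed

text \<open>Equal factors have equal lengths, so for \<open>k > length u + 2 * N\<close> the cut lies after \<open>u * T\<^sub>j\<close>
  for some \<open>j \<ge> N\<close>, and the right factor is a subword of \<open>T\<close>.\<close>

lemma unequal_factors:
  assumes "t \<noteq> []"
    and N: "\<And>n i. \<lbrakk>n \<ge> N; i < length t\<rbrakk> \<Longrightarrow> u @ T_sub t 0 n \<noteq> T_sub t i (length u + n)"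
    and k: "k > length u + 2 * N"
  shows "take c (u @ T_sub t 0 k) \<noteq> drop c (u @ T_sub t 0 k)"
proof
  assume eq: "take c (u @ T_sub t 0 k) = drop c (u @ T_sub t 0 k)"
  then have "min (length u + k) c = length u + k - c"
    by (metis length_take length_drop length_append length_T_sub)
  then have len: "2 * c = length u + k" using k by (simp add: min_def split: if_splits)
  define j where "j = c - length u"
  have c: "c = length u + j" and "j \<ge> N" and kj: "k = length u + 2 * j"
    using len k by (auto simp: j_def)
  have "u @ T_sub t 0 j = T_sub t (j mod length t) (length u + j)"
    using eq kj by (simp add: c take_T_sub drop_T_sub T_sub_mod[OF \<open>t \<noteq> []\<close>] add.commute)
  then show False using N[OF \<open>j \<ge> N\<close>, of "j mod length t"] \<open>t \<noteq> []\<close> by simp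
qed

lemma card_cuts_append_T_sub:
  assumes "t \<noteq> []"
  shows "card {c. c \<le> length u + k \<and> take c (u @ T_sub t 0 k) \<in> ulam \<and> drop c (u @ T_sub t 0 k) \<in> ulam}
    = card {c \<in> {0<..<length u}. take c u \<in> ulam \<and> drop c u @ T_sub t 0 k \<in> ulam}
    + card {j. j < k \<and> u @ T_sub t 0 j \<in> ulam \<and> T_sub t (j mod length t) (k - j) \<in> ulam}"
    (is "card ?C = card ?A + card ?B")
proof -
  have "?C = ?A \<union> (\<lambda>j. length u + j) ` ?B"
  proof (intro set_eqI iffI)
    fix c assume c: "c \<in> ?C"
    then have "take c (u @ T_sub t 0 k) \<noteq> []" "drop c (u @ T_sub t 0 k) \<noteq> []"
      using ulam_nonempty by (metis (no_types, lifting) mem_Collect_eq)+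
    then have "0 < length (take c (u @ T_sub t 0 k))" "0 < length (drop c (u @ T_sub t 0 k))"
      by (simp_all only: length_greater_0_conv not_False_eq_True)
    then have bounds: "0 < c" "c < length u + k"
      unfolding length_take length_drop length_append length_T_sub by linarith+
    show "c \<in> ?A \<union> (\<lambda>j. length u + j) ` ?B"
    proof (cases "c < length u")
      case True
      then show ?thesis using c bounds by simp
    next
      case False
      then obtain j where j: "c = length u + j" using le_Suc_ex[of "length u" c] by auto
      then have "j \<in> ?B"
        using c bounds by (simp add: take_T_sub drop_T_sub T_sub_mod[OF assms])
      then show ?thesis using j by blast
    qed
  next
    fix c assume "c \<in> ?A \<union> (\<lambda>j. length u + j) ` ?B"
    then show "c \<in> ?C"
      by (auto simp: take_T_sub drop_T_sub T_sub_mod[OF assms])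
  qed
  moreover have "?A \<inter> (\<lambda>j. length u + j) ` ?B = {}" by auto
  moreover have "inj_on (\<lambda>j. length u + j) ?B" by (simp add: inj_on_def)
  ultimately show ?thesis by (simp add: card_Un_disjoint card_image)
qed

section \<open>Periodicity of Ulam words with a periodic tail\<close>

theorem theorem3p9:
  fixes t :: word
  assumes "t \<in> W2"
    and "\<forall>i < length t. eventually_periodic {k. T_sub t i k \<in> ulam}"
  shows "\<forall>u \<in> W2. eventually_periodic {k. u @ T_sub t 0 k \<in> ulam}"
proof
  fix u :: word assume "u \<in> W2"
  have t: "t \<noteq> []" using assms(1) by (simp add: W2_def)
  show "eventually_periodic {k. u @ T_sub t 0 k \<in> ulam}"
    using \<open>u \<in> W2\<close>
  proof (induction u rule: length_induct)
    case (1 u)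
    then have u: "u \<noteq> []" by (simp add: W2_def)
    show ?case
    proof (cases "\<exists>i<length t. \<forall>n. u @ T_sub t 0 n = T_sub t i (length u + n)")
      case True
      then obtain i where i: "i < length t" "\<forall>n. u @ T_sub t 0 n = T_sub t i (length u + n)" by blast
      then have "{k. u @ T_sub t 0 k \<in> ulam} = {k. length u + k \<in> {k. T_sub t i k \<in> ulam}}" by simp
      then show ?thesis
        using eventually_periodic_shift[of "{k. T_sub t i k \<in> ulam}" "length u"] assms(2) i(1) by simp
    next
      case False
      then have "\<exists>n. u @ T_sub t 0 n \<noteq> T_sub t i (length u + n)" if "i < length t" for i
        using that by blast
      then obtain N where
        N: "\<And>n i. \<lbrakk>n \<ge> N; i < length t\<rbrakk> \<Longrightarrow> u @ T_sub t 0 n \<noteq> T_sub t i (length u + n)"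
        using not_shift_eventually_not_subword[of "length t" u t] by blast
      define G where "G c = {k. take c u \<in> ulam \<and> k \<in> {k. drop c u @ T_sub t 0 k \<in> ulam}}" for c
      show ?thesis
      \<comment> \<open>\<open>G c\<close> describes the cut at position \<open>c\<close> inside \<open>u\<close>; the cut right after \<open>u\<close> is the term
        \<open>j = 0\<close> of the convolution.\<close>
      proof (rule self_convolution_eventually_periodic
          [where m = "length t" and C = "{0<..<length u}" and G = G
            and B = "\<lambda>i. {k. T_sub t i k \<in> ulam}" and L = "Suc (length u + 2 * N)"])
        show "eventually_periodic (G c)" if "c \<in> {0<..<length u}" for c
          unfolding G_def
          by (rule eventually_periodic_conj_const) (use 1 that in \<open>simp add: W2_def\<close>)
        fix k assume k: "k \<ge> Suc (length u + 2 * N)"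
        have "u @ T_sub t 0 k \<in> ulam \<longleftrightarrow>
            card {c. c \<le> length u + k \<and> take c (u @ T_sub t 0 k) \<in> ulam \<and> drop c (u @ T_sub t 0 k) \<in> ulam} = 1"
        proof -
          have ne: "take c (u @ T_sub t 0 k) \<noteq> drop c (u @ T_sub t 0 k)" for c
            by (rule unequal_factors[OF t N]) (use k in auto)
          have "2 \<le> length (u @ T_sub t 0 k)" using u k by (cases u) auto
          from ulam_iff_cuts[OF this] show ?thesis
            by (simp only: ne length_append length_T_sub simp_thms not_False_eq_True)
        qed
        then show "k \<in> {k. u @ T_sub t 0 k \<in> ulam} \<longleftrightarrow>
            card {c \<in> {0<..<length u}. k \<in> G c} +
            card {j. j < k \<and> j \<in> {k. u @ T_sub t 0 k \<in> ulam} \<and>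
              k - j \<in> {k. T_sub t (j mod length t) k \<in> ulam}} = 1"
          unfolding card_cuts_append_T_sub[OF t] by (simp add: G_def)
      qed (use t assms(2) in auto)
    qed
  qed
qed

end
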